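(* Let $\psi$ be a waiting-time density on $\mathbb{N}=\{1,2,\dots\}$ and let $Y_t=2N(t)-t$ be the simple ADTRW whose generator process $N(t)$ has waiting-time density $\psi$. The walk is strictly unbiased if and only if $N$ is the symmetric Bernoulli process, i.e. if and only if $\psi(t)=2^{-t}$ for all $t\in\mathbb{N}$, equivalently $\bar\psi(u)=\sum_{t\ge1}\psi(t)u^t=\dfrac{u}{2(1-u/2)}$. Moreover, this is the only simple ADTRW for which $\mathbb{E}[Y_t]=0$ for all $t\in\mathbb{N}_0$.
   Context: A waiting-time density is a function $\psi:\mathbb{N}\to[0,1]$ with $\sum_{t\ge1}\psi(t)=1$. The generator process with waiting-time density $\psi$ is the discrete-time renewal counting process $N(t)=\max\{n\ge 0:\Delta t_1+\dots+\Delta t_n\le t\}$, $t\in\mathbb{N}_0$, where $\Delta t_1,\Delta t_2,\dots$ are i.i.d. with $\mathbb{P}(\Delta t_j=t)=\psi(t)$. The simple asymmetric discrete-time random walk (simple ADTRW) is $Y_t=2N(t)-t$ on $\mathbb{Z}$, $Y_0=0$. Put $\Lambda(a,b,t)=\mathbb{E}[a^{N(t)}b^{t-N(t)}]=\sum_{n=0}^t\mathbb{P}(N(t)=n)a^nb^{t-n}$. The walk is called strictly unbiased if (i) $A_1:=\sum_{t\ge1}t\,\psi(t)=2$ and (ii) $\Lambda(a,b,t)=\Lambda(b,a,t)$ for all $a,b$ and all $t\in\mathbb{N}_0$. *)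

theory Defs
  imports "HOL-Probability.Probability"
begin

text \<open>
  The set of positive integers is \<^term>\<open>{1..} :: nat set\<close>; the value of a waiting-time density
  at \<^term>\<open>0 :: nat\<close> is irrelevant and never used.
\<close>

definition waiting_time_density :: "(nat \<Rightarrow> real) \<Rightarrow> bool" where
  "waiting_time_density \<psi> \<longleftrightarrow>
     (\<forall>t\<ge>1. 0 \<le> \<psi> t \<and> \<psi> t \<le> 1) \<and> (\<psi> has_sum 1) {1..}"

definition waiting_time_gf :: "(nat \<Rightarrow> real) \<Rightarrow> real \<Rightarrow> real" where
  "waiting_time_gf \<psi> u = (\<Sum>\<^sub>\<infinity>t\<in>{1..}. \<psi> t * u ^ t)"

text \<open>\<^term>\<open>X j\<close> is the waiting time usually called \<open>\<Delta>t\<^sub>j\<^sub>+\<^sub>1\<close>.\<close>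

locale iid_waiting_times = prob_space M
  for M :: "'a measure" +
  fixes \<psi> :: "nat \<Rightarrow> real" and X :: "nat \<Rightarrow> 'a \<Rightarrow> nat"
  assumes density: "waiting_time_density \<psi>"
    and positive: "\<And>j \<omega>. \<omega> \<in> space M \<Longrightarrow> X j \<omega> \<ge> 1"
    and indep: "indep_vars (\<lambda>_. count_space UNIV) X UNIV"
    and law: "\<And>j t. t \<ge> 1 \<Longrightarrow> prob {\<omega> \<in> space M. X j \<omega> = t} = \<psi> t"

lemma iid_waiting_times_exist:
  assumes d: "waiting_time_density \<psi>"
  shows "\<exists>(M :: (nat \<Rightarrow> nat) measure) X. iid_waiting_times M \<psi> X"
proof -
  define f where "f = (\<lambda>t::nat. if t \<ge> 1 then \<psi> t else 0)"
  have f0: "f t \<ge> 0" for t using d by (auto simp: f_def waiting_time_density_def)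
  have hs: "(f has_sum 1) UNIV"
  proof -
    have "(\<psi> has_sum 1) {1..}" using d by (simp add: waiting_time_density_def)
    then show ?thesis by (rule has_sum_cong_neutral[THEN iffD1, rotated -1]) (auto simp: f_def)
  qed
  have nn: "(\<integral>\<^sup>+ t. ennreal (f t) \<partial>count_space UNIV) = 1"
    using has_sum_imp_sums[OF hs] f0
    by (simp add: nn_integral_count_space_nat suminf_ennreal2 sums_iff)
  define p where "p = embed_pmf f"
  have pm: "pmf p t = f t" for t unfolding p_def by (rule pmf_embed_pmf) (use f0 nn in auto)
  define M where "M = PiM (UNIV :: nat set) (\<lambda>_. measure_pmf p)"
  define X where "X = (\<lambda>j (\<omega> :: nat \<Rightarrow> nat). max 1 (\<omega> j))"
  interpret P: product_prob_space "\<lambda>_::nat. measure_pmf p" UNIV ..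
  interpret Q: prob_space M unfolding M_def by (rule P.prob_space_axioms)
  have dc: "distr M (measure_pmf p) (\<lambda>\<omega>. \<omega> j) = measure_pmf p" for j
    unfolding M_def by (rule P.PiM_component) simp
  have i: "Q.indep_vars (\<lambda>_. measure_pmf p) (\<lambda>j \<omega>. \<omega> j) UNIV"
  proof (subst Q.indep_vars_iff_distr_eq_PiM')
    show "distr M (PiM UNIV (\<lambda>_. measure_pmf p)) (\<lambda>x. \<lambda>i\<in>UNIV. x i) =
        PiM UNIV (\<lambda>i. distr M (measure_pmf p) (\<lambda>\<omega>. \<omega> i))"
      unfolding dc by (simp add: M_def restrict_def distr_id2)
  qed (auto simp: M_def)
  have ind: "Q.indep_vars (\<lambda>_. count_space UNIV) X UNIV"
    unfolding X_def by (rule Q.indep_vars_compose2[OF i]) simp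
  have law: "Q.prob {\<omega> \<in> space M. X j \<omega> = t} = \<psi> t" if "t \<ge> 1" for j t
  proof -
    have meas: "(\<lambda>\<omega>. \<omega> j) \<in> measurable M (measure_pmf p)"
      unfolding M_def by (rule measurable_component_singleton) simp
    have "Q.prob {\<omega> \<in> space M. X j \<omega> = t} = measure (measure_pmf p) {s. max 1 s = t}"
      by (subst dc[of j, symmetric], subst measure_distr[OF meas]) 
        (auto simp: X_def intro!: arg_cong[where f = Q.prob])
    also have "\<dots> = measure (measure_pmf p) ({s. max 1 s = t} \<inter> set_pmf p)"
      by (simp add: measure_Int_set_pmf)
    also have "{s. max 1 s = t} \<inter> set_pmf p = {t} \<inter> set_pmf p"
      using that by (auto simp: set_pmf_iff pm f_def max_def split: if_splits)
    also have "measure (measure_pmf p) \<dots> = \<psi> t"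
      using that by (simp only: measure_Int_set_pmf) (simp add: measure_pmf_single pm f_def)
    finally show ?thesis .
  qed
  have "iid_waiting_times M \<psi> X"
    by unfold_locales (use d ind law in \<open>auto simp: X_def\<close>)
  then show ?thesis by blast
qed

text \<open>The set below is finite because every waiting time is at least \<open>1\<close>.\<close>

definition renewal_count :: "(nat \<Rightarrow> 'a \<Rightarrow> nat) \<Rightarrow> nat \<Rightarrow> 'a \<Rightarrow> nat" where
  "renewal_count X t \<omega> = Max {n. (\<Sum>j<n. X j \<omega>) \<le> t}"

definition simple_ADTRW :: "(nat \<Rightarrow> 'a \<Rightarrow> nat) \<Rightarrow> nat \<Rightarrow> 'a \<Rightarrow> int" where
  "simple_ADTRW X t \<omega> = 2 * int (renewal_count X t \<omega>) - int t"

text \<open>The truncated subtraction is harmless, since the count at time \<open>t\<close> is at most \<open>t\<close>.\<close>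

definition walk_gf :: "'a measure \<Rightarrow> (nat \<Rightarrow> 'a \<Rightarrow> nat) \<Rightarrow> real \<Rightarrow> real \<Rightarrow> nat \<Rightarrow> real" where
  "walk_gf M X a b t =
     (LINT \<omega>|M. a ^ renewal_count X t \<omega> * b ^ (t - renewal_count X t \<omega>))"

definition strictly_unbiased ::
    "'a measure \<Rightarrow> (nat \<Rightarrow> real) \<Rightarrow> (nat \<Rightarrow> 'a \<Rightarrow> nat) \<Rightarrow> bool" where
  "strictly_unbiased M \<psi> X \<longleftrightarrow>
     ((\<lambda>t. real t * \<psi> t) has_sum 2) {1..} \<and>
     (\<forall>a b t. walk_gf M X a b t = walk_gf M X b a t)"

text \<open>
  Counting process of successes in independent Bernoulli trials with success probability
  \<^term>\<open>p\<close>, one trial at each of the times \<open>1, 2, \<dots>\<close>.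
\<close>

definition bernoulli_process :: "'a measure \<Rightarrow> real \<Rightarrow> (nat \<Rightarrow> 'a \<Rightarrow> nat) \<Rightarrow> bool" where
  "bernoulli_process M p N \<longleftrightarrow>
     (\<forall>\<omega>\<in>space M. N 0 \<omega> = 0) \<and>
     prob_space.indep_vars M (\<lambda>_. count_space UNIV)
       (\<lambda>t \<omega>. int (N (Suc t) \<omega>) - int (N t \<omega>)) UNIV \<and>
     (\<forall>t. distr M (count_space UNIV) (\<lambda>\<omega>. int (N (Suc t) \<omega>) - int (N t \<omega>)) =
            measure_pmf (map_pmf of_bool (bernoulli_pmf p)))"

end

theory Submission
  imports Defs "HOL-Complex_Analysis.Cauchy_Integral_Formula"
begin

text \<open>
  Everything is read off from the random set of renewal epochs
  \<open>{S\<^sub>n | n \<ge> 0}\<close>, where \<open>S\<^sub>n = \<Delta>t\<^sub>1 + \<dots> + \<Delta>t\<^sub>n\<close>. As all waiting times are at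
  least \<open>1\<close>, the increment \<open>N(t+1) - N(t)\<close> is the indicator of the event that \<open>t + 1\<close> is
  an epoch (\<open>renewal_count_Suc\<close>). After the first epoch the process starts afresh with the shifted
  waiting times, so conditioning on \<open>\<Delta>t\<^sub>1 = s\<close> expresses the probability that all members of
  a set \<open>J\<close> are epochs through the translated sets \<open>J - s\<close> (\<open>first_renewal_decomposition\<close>). This
  recursion is used twice.

  If \<open>\<psi>(t) = 2\<^sup>-\<^sup>t\<close>, induction shows that all \<open>k\<close> members of a set of positive times are
  epochs with probability \<open>2\<^sup>-\<^sup>k\<close> (\<open>prob_renewals_geometric\<close>), so the increments are independent
  fair bits (\<open>bernoulli_if_geometric\<close>) and \<open>E[Y\<^sub>t] = 0\<close>. Conversely, \<open>E[Y\<^sub>t] = 0\<close> for all \<open>t\<close> says that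
  every positive time is an epoch with probability \<open>1/2\<close>. For the singletons \<open>J = {t}\<close> the recursion
  is the renewal equation \<open>1/2 = \<psi>(t) + (\<psi>(1) + \<dots> + \<psi>(t-1))/2\<close>, which determines \<open>\<psi>\<close>
  (\<open>geometric_if_centred\<close>).

  For strict unbiasedness, two evaluations of the symmetry of \<open>\<Lambda>\<close> are enough:
  \<open>\<Lambda>(0,1,t) = P(N(t) = 0) = P(\<Delta>t\<^sub>1 > t)\<close> and \<open>\<Lambda>(1,0,t) = P(N(t) = t) = \<psi>(1)\<^sup>t\<close>.
  Their equality at \<open>t = 1\<close> gives \<open>\<psi>(1) = 1/2\<close>, and then the tail of \<open>\<Delta>t\<^sub>1\<close> is \<open>2\<^sup>-\<^sup>t\<close>
  (\<open>geometric_if_strictly_unbiased\<close>). In the other direction independent fair bits give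
  \<open>\<Lambda>(a,b,t) = ((a+b)/2)\<^sup>t\<close> (\<open>walk_gf_if_bernoulli\<close>), which is symmetric, and whose value at
  \<open>(0,1)\<close> again is the tail of \<open>\<Delta>t\<^sub>1\<close>.
\<close>

section \<open>Renewal epochs\<close>

definition partial_sum :: "(nat \<Rightarrow> 'a \<Rightarrow> nat) \<Rightarrow> nat \<Rightarrow> 'a \<Rightarrow> nat" where
  "partial_sum X n \<omega> = (\<Sum>j<n. X j \<omega>)"

definition renewal_at :: "(nat \<Rightarrow> 'a \<Rightarrow> nat) \<Rightarrow> nat \<Rightarrow> 'a \<Rightarrow> bool" where
  "renewal_at X t \<omega> \<longleftrightarrow> (\<exists>n. partial_sum X n \<omega> = t)"

definition shift :: "(nat \<Rightarrow> 'a \<Rightarrow> nat) \<Rightarrow> nat \<Rightarrow> 'a \<Rightarrow> nat" where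
  "shift X j = X (Suc j)"

lemma partial_sum_0 [simp]: "partial_sum X 0 \<omega> = 0"
  by (simp add: partial_sum_def)

lemma partial_sum_Suc: "partial_sum X (Suc n) \<omega> = partial_sum X n \<omega> + X n \<omega>"
  by (simp add: partial_sum_def)

lemma partial_sum_Suc_shift: "partial_sum X (Suc n) \<omega> = X 0 \<omega> + partial_sum (shift X) n \<omega>"
  unfolding partial_sum_def shift_def by (rule sum.lessThan_Suc_shift)

lemma renewal_at_0 [simp]: "renewal_at X 0 \<omega>"
  unfolding renewal_at_def by (rule exI[of _ 0]) simp

text \<open>
  A positive epoch is never \<open>S\<^sub>0\<close>, so the first waiting time can be split off: pathwise, this is the
  statement that the process starts afresh after its first renewal.
\<close>

lemma renewal_at_iff_shift:
  assumes "t \<ge> 1"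
  shows "renewal_at X t \<omega> \<longleftrightarrow> X 0 \<omega> \<le> t \<and> renewal_at (shift X) (t - X 0 \<omega>) \<omega>"
proof
  assume "renewal_at X t \<omega>"
  then obtain n where n: "partial_sum X n \<omega> = t" by (auto simp: renewal_at_def)
  with assms obtain m where "n = Suc m" by (cases n) auto
  with n have "X 0 \<omega> + partial_sum (shift X) m \<omega> = t" by (simp add: partial_sum_Suc_shift)
  then show "X 0 \<omega> \<le> t \<and> renewal_at (shift X) (t - X 0 \<omega>) \<omega>"
    by (auto simp: renewal_at_def)
next
  assume *: "X 0 \<omega> \<le> t \<and> renewal_at (shift X) (t - X 0 \<omega>) \<omega>"
  then obtain m where "partial_sum (shift X) m \<omega> = t - X 0 \<omega>" by (auto simp: renewal_at_def)
  with * have "partial_sum X (Suc m) \<omega> = t" by (simp add: partial_sum_Suc_shift)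
  then show "renewal_at X t \<omega>" by (auto simp: renewal_at_def)
qed

text \<open>The pathwise facts concern a single outcome, which is therefore fixed.\<close>

locale positive_waiting_times =
  fixes X :: "nat \<Rightarrow> 'a \<Rightarrow> nat" and \<omega> :: 'a
  assumes pos: "X j \<omega> \<ge> 1"
begin

lemma strict_mono_partial_sum: "strict_mono (\<lambda>n. partial_sum X n \<omega>)"
  unfolding strict_mono_Suc_iff using pos by (simp add: partial_sum_Suc Suc_le_eq)

lemma le_partial_sum: "n \<le> partial_sum X n \<omega>"
  using strict_mono_partial_sum by (rule strict_mono_imp_increasing)

text \<open>
  The duality between counts and epochs; it replaces the maximum in the definition of the count
  in all that follows.
\<close>

lemma le_renewal_count_iff: "n \<le> renewal_count X t \<omega> \<longleftrightarrow> partial_sum X n \<omega> \<le> t"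
proof -
  let ?A = "{n. partial_sum X n \<omega> \<le> t}"
  have fin: "finite ?A"
    by (rule finite_subset[of _ "{..t}"]) (auto intro: le_trans[OF le_partial_sum])
  have ne: "?A \<noteq> {}" by (auto intro: exI[of _ 0])
  have N: "renewal_count X t \<omega> = Max ?A" by (simp add: renewal_count_def partial_sum_def)
  show ?thesis
  proof
    assume "n \<le> renewal_count X t \<omega>"
    then have "partial_sum X n \<omega> \<le> partial_sum X (Max ?A) \<omega>"
      unfolding N using strict_mono_less_eq[OF strict_mono_partial_sum] by simp
    also have "\<dots> \<le> t" using Max_in[OF fin ne] by simp
    finally show "partial_sum X n \<omega> \<le> t" .
  qed (use Max_ge[OF fin] in \<open>simp add: N\<close>)
qed

lemma renewal_count_le: "renewal_count X t \<omega> \<le> t"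
  using le_renewal_count_iff[of "renewal_count X t \<omega>" t] le_partial_sum le_trans by blast

lemma renewal_count_0: "renewal_count X 0 \<omega> = 0"
  using renewal_count_le[of 0] by simp

text \<open>
  Epochs are strictly increasing integers, so at most one falls on each time step. If \<open>t + 1\<close> is an
  epoch, it must be the first one that exceeds \<open>t\<close>.
\<close>

lemma renewal_count_Suc:
  "renewal_count X (Suc t) \<omega> = renewal_count X t \<omega> + of_bool (renewal_at X (Suc t) \<omega>)"
proof -
  let ?N = "renewal_count X t \<omega>"
  have gt: "partial_sum X (Suc ?N) \<omega> > t"
    using le_renewal_count_iff[of "Suc ?N" t] by simp
  have le: "partial_sum X ?N \<omega> \<le> t" using le_renewal_count_iff[of ?N t] by simp
  have 1: "renewal_at X (Suc t) \<omega> \<longleftrightarrow> partial_sum X (Suc ?N) \<omega> = Suc t"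
  proof
    assume "renewal_at X (Suc t) \<omega>"
    then obtain n where n: "partial_sum X n \<omega> = Suc t" by (auto simp: renewal_at_def)
    with le have "?N < n"
      using strict_mono_less[OF strict_mono_partial_sum, of ?N n] by simp
    then have "partial_sum X (Suc ?N) \<omega> \<le> Suc t"
      using strict_mono_less_eq[OF strict_mono_partial_sum, of "Suc ?N" n] n by simp
    with gt show "partial_sum X (Suc ?N) \<omega> = Suc t" by simp
  qed (auto simp: renewal_at_def)
  have "partial_sum X (Suc (Suc ?N)) \<omega> > Suc t"
    using gt pos[of "Suc ?N"] by (simp add: partial_sum_Suc[of X "Suc ?N"])
  then have "renewal_count X (Suc t) \<omega> \<le> Suc ?N"
    using le_renewal_count_iff[of "Suc (Suc ?N)" "Suc t"] by simp
  moreover have "?N \<le> renewal_count X (Suc t) \<omega>"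
    using le by (simp add: le_renewal_count_iff)
  moreover have "Suc ?N \<le> renewal_count X (Suc t) \<omega> \<longleftrightarrow> renewal_at X (Suc t) \<omega>"
    unfolding le_renewal_count_iff 1 using gt by linarith
  ultimately show ?thesis by (cases "renewal_at X (Suc t) \<omega>") auto
qed

lemma renewal_count_eq_sum: "renewal_count X t \<omega> = (\<Sum>s<t. of_bool (renewal_at X (Suc s) \<omega>))"
  by (induction t) (simp_all add: renewal_count_0 renewal_count_Suc)

lemma renewal_count_eq_0_iff: "renewal_count X t \<omega> = 0 \<longleftrightarrow> X 0 \<omega> > t"
  using le_renewal_count_iff[of 1 t] by (auto simp: partial_sum_def)

lemma renewal_count_eq_self_iff: "renewal_count X t \<omega> = t \<longleftrightarrow> (\<forall>j<t. X j \<omega> = 1)"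
proof -
  have "renewal_count X t \<omega> = t \<longleftrightarrow> partial_sum X t \<omega> \<le> t"
    using le_renewal_count_iff[of t t] renewal_count_le[of t] by auto
  also have "\<dots> \<longleftrightarrow> (\<forall>j<t. X j \<omega> = 1)"
  proof (induction t)
    case (Suc t)
    then show ?case
      using pos[of t] le_partial_sum[of t] by (auto simp: partial_sum_Suc less_Suc_eq)
  qed auto
  finally show ?thesis .
qed

end

section \<open>The first renewal\<close>

text \<open>Shifted waiting times are independent because shifting merely reindexes the family.\<close>

lemma (in prob_space) indep_vars_inj:
  assumes X: "indep_vars M' X UNIV" and "inj f"
  shows "indep_vars (\<lambda>i. M' (f i)) (\<lambda>i. X (f i)) UNIV"
  unfolding indep_vars_def2
proof (intro conjI ballI)
  show "random_variable (M' (f i)) (X (f i))" for i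
    using X by (auto simp: indep_vars_def2)
  show "indep_sets (\<lambda>i. {X (f i) -` A \<inter> space M | A. A \<in> sets (M' (f i))}) UNIV"
  proof (rule indep_setsI)
    fix A J assume J: "J \<noteq> {}" "finite J"
      and A: "\<forall>j\<in>J. A j \<in> {X (f j) -` B \<inter> space M | B. B \<in> sets (M' (f j))}"
    have "prob (\<Inter>k\<in>f ` J. A (inv f k)) = (\<Prod>k\<in>f ` J. prob (A (inv f k)))"
      by (rule indep_setsD[of "\<lambda>k. {X k -` B \<inter> space M | B. B \<in> sets (M' k)}" UNIV])
         (use X J A \<open>inj f\<close> in \<open>auto simp: indep_vars_def2\<close>)
    then show "prob (\<Inter>j\<in>J. A j) = (\<Prod>j\<in>J. prob (A j))"
      using \<open>inj f\<close> by (simp add: prod.reindex inj_on_subset)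
  qed (use X in \<open>auto simp: indep_vars_def2 intro: measurable_sets\<close>)
qed

context iid_waiting_times
begin

lemma positive_waiting_times: "\<omega> \<in> space M \<Longrightarrow> positive_waiting_times X \<omega>"
  by unfold_locales (rule positive)

lemma measurable_X [measurable]: "X j \<in> measurable M (count_space UNIV)"
  using indep by (simp add: indep_vars_def)

lemma measurable_partial_sum [measurable]: "partial_sum X n \<in> measurable M (count_space UNIV)"
  by (induction n) (simp_all add: partial_sum_def[abs_def])

lemma measurable_renewal_at [measurable]: "Measurable.pred M (renewal_at X t)"
  unfolding renewal_at_def[abs_def] by measurable

lemma iid_shift: "iid_waiting_times M \<psi> (shift X)"
proof unfold_locales
  show "indep_vars (\<lambda>_. count_space UNIV) (shift X) UNIV"
    using indep_vars_inj[OF indep, of Suc] by (simp add: shift_def[abs_def])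
qed (use density positive law in \<open>auto simp: shift_def\<close>)

text \<open>
  The first waiting time depends on the coordinate \<open>0\<close> alone and the epochs of the shifted process
  on the other coordinates, and disjoint blocks of coordinates are independent.
\<close>

lemma prob_first_and_shift:
  assumes s: "s \<ge> 1"
  shows "prob {\<omega>\<in>space M. X 0 \<omega> = s \<and> (\<forall>t\<in>K. renewal_at (shift X) t \<omega>)} =
         \<psi> s * prob {\<omega>\<in>space M. \<forall>t\<in>K. renewal_at (shift X) t \<omega>}"
proof -
  let ?P0 = "PiM {0::nat} (\<lambda>_. count_space (UNIV::nat set))"
  let ?P1 = "PiM (range Suc) (\<lambda>_. count_space (UNIV::nat set))"
  define A where "A = {f \<in> space ?P0. f 0 = s}"
  define B where "B = {f \<in> space ?P1. \<forall>t\<in>K. \<exists>n. (\<Sum>j<n. f (Suc j)) = t}"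
  have ind: "indep_var ?P0 (\<lambda>\<omega>. restrict (\<lambda>i. X i \<omega>) {0}) ?P1 (\<lambda>\<omega>. restrict (\<lambda>i. X i \<omega>) (range Suc))"
    by (rule indep_var_restrict[OF indep]) auto
  have A: "A \<in> sets ?P0" unfolding A_def by measurable
  have B: "B \<in> sets ?P1" unfolding B_def by measurable
  have eq1: "(\<lambda>\<omega>. restrict (\<lambda>i. X i \<omega>) {0}) -` A \<inter> space M = {\<omega>\<in>space M. X 0 \<omega> = s}"
    by (auto simp: A_def space_PiM)
  have eq2: "(\<lambda>\<omega>. restrict (\<lambda>i. X i \<omega>) (range Suc)) -` B \<inter> space M =
      {\<omega>\<in>space M. \<forall>t\<in>K. renewal_at (shift X) t \<omega>}"
    by (auto simp: B_def space_PiM renewal_at_def partial_sum_def shift_def)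
  have "{\<omega>\<in>space M. X 0 \<omega> = s \<and> (\<forall>t\<in>K. renewal_at (shift X) t \<omega>)} =
     (\<lambda>\<omega>. (restrict (\<lambda>i. X i \<omega>) {0}, restrict (\<lambda>i. X i \<omega>) (range Suc))) -` (A \<times> B) \<inter> space M"
    using eq1 eq2 by blast
  then show ?thesis
    using indep_varD[OF ind A B] law[OF s, of 0] by (simp add: eq1 eq2)
qed

text \<open>
  The renewal equation, for finitely or infinitely many epochs at once. The first epoch is at most
  \<open>m = Min J\<close>, since otherwise \<open>m\<close> would be skipped; as \<open>s \<le> m\<close>, the subtractions are not truncated.
\<close>

lemma first_renewal_decomposition:
  assumes J: "J \<noteq> {}" and m: "\<And>t. t \<in> J \<Longrightarrow> m \<le> t" "m \<in> J" "m \<ge> 1"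
  shows "prob {\<omega>\<in>space M. \<forall>t\<in>J. renewal_at X t \<omega>} =
    (\<Sum>s=1..m. \<psi> s * prob {\<omega>\<in>space M. \<forall>t\<in>(\<lambda>t. t - s) ` J. renewal_at (shift X) t \<omega>})"
proof -
  interpret S: iid_waiting_times M \<psi> "shift X" by (rule iid_shift)
  let ?E = "\<lambda>s. {\<omega>\<in>space M. X 0 \<omega> = s \<and> (\<forall>t\<in>(\<lambda>t. t - s) ` J. renewal_at (shift X) t \<omega>)}"
  have "{\<omega>\<in>space M. \<forall>t\<in>J. renewal_at X t \<omega>} = (\<Union>s\<in>{1..m}. ?E s)"
  proof -
    have "(\<forall>t\<in>J. renewal_at X t \<omega>) \<longleftrightarrow> (\<exists>s\<in>{1..m}. \<omega> \<in> ?E s)" if "\<omega> \<in> space M" for \<omega>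
    proof -
      have "(\<forall>t\<in>J. renewal_at X t \<omega>) \<longleftrightarrow>
        X 0 \<omega> \<le> m \<and> (\<forall>t\<in>J. renewal_at (shift X) (t - X 0 \<omega>) \<omega>)"
        using m le_trans renewal_at_iff_shift[of _ X \<omega>] by meson
      also have "\<dots> \<longleftrightarrow> (\<exists>s\<in>{1..m}. \<omega> \<in> ?E s)"
        using positive[OF that, of 0] that by auto
      finally show ?thesis .
    qed
    then show ?thesis by blast
  qed
  moreover have "prob (\<Union>s\<in>{1..m}. ?E s) = (\<Sum>s=1..m. prob (?E s))"
    by (rule finite_measure_finite_Union) (auto simp: disjoint_family_on_def)
  moreover have "prob (?E s) =
      \<psi> s * prob {\<omega>\<in>space M. \<forall>t\<in>(\<lambda>t. t - s) ` J. renewal_at (shift X) t \<omega>}" if "s \<in> {1..m}" for s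
    using that by (intro prob_first_and_shift) simp
  ultimately show ?thesis by (simp only: cong: sum.cong)
qed

end

text \<open>
  The renewal equation determines the renewal mass from \<open>\<psi>\<close>. The lemma is applied to \<open>X\<close> and its
  shift: a hypothesis on the renewal mass of \<open>X\<close> thereby transfers to the right-hand side of the
  renewal equation.
\<close>

lemma renewal_mass_unique:
  assumes "iid_waiting_times M \<psi> X" "iid_waiting_times M \<psi> Y"
  shows "measure M {\<omega>\<in>space M. renewal_at X t \<omega>} = measure M {\<omega>\<in>space M. renewal_at Y t \<omega>}"
  using assms
proof (induction t arbitrary: X Y rule: less_induct)
  case (less t)
  show ?case
  proof (cases "t = 0")
    case False
    interpret X: iid_waiting_times M \<psi> X by fact
    interpret Y: iid_waiting_times M \<psi> Y by fact
    show ?thesis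
      using False X.first_renewal_decomposition[of "{t}" t] Y.first_renewal_decomposition[of "{t}" t]
        less.IH[OF _ X.iid_shift Y.iid_shift]
      by simp
  qed simp
qed

lemma sum_half_powers: "(\<Sum>s=1..n. 1 / 2 ^ s) = 1 - 1 / (2::real) ^ n"
  by (induction n) (auto simp: field_simps)

text \<open>
  Induction on a bound for \<open>J\<close>. Let \<open>m\<close> be the least and \<open>k\<close> the number of positive members of \<open>J\<close>.
  Translating by \<open>s < m\<close> keeps all of them positive; translating by \<open>m\<close> turns one of them into \<open>0\<close>,
  which is always an epoch. The sum is thus
  \<open>(1 - 2\<^sup>-\<^sup>(\<^sup>m\<^sup>-\<^sup>1\<^sup>)) 2\<^sup>-\<^sup>k + 2\<^sup>-\<^sup>m 2\<^sup>-\<^sup>(\<^sup>k\<^sup>-\<^sup>1\<^sup>) = 2\<^sup>-\<^sup>k\<close>. The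
  time \<open>0\<close> is admitted in \<open>J\<close> because translation produces it.
\<close>

lemma prob_renewals_geometric:
  assumes "iid_waiting_times M \<psi> X" and \<psi>: "\<And>t. t \<ge> 1 \<Longrightarrow> \<psi> t = 1 / 2 ^ t" and "finite J"
  shows "measure M {\<omega>\<in>space M. \<forall>t\<in>J. renewal_at X t \<omega>} = 1 / 2 ^ card (J - {0})"
proof -
  define n where "n = Max (insert 0 J)"
  from \<open>finite J\<close> have "J \<subseteq> {..n}" by (auto simp: n_def)
  then show ?thesis using assms(1)
  proof (induction n arbitrary: X J rule: less_induct)
    case (less n)
    interpret X: iid_waiting_times M \<psi> X by fact
    have fin: "finite J" using less.prems(1) finite_subset by blast
    let ?J = "J - {0}"
    have "{\<omega>\<in>space M. \<forall>t\<in>J. renewal_at X t \<omega>} = {\<omega>\<in>space M. \<forall>t\<in>?J. renewal_at X t \<omega>}"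
      using renewal_at_0[of X] by (metis Diff_iff singletonD)
    moreover have "measure M {\<omega>\<in>space M. \<forall>t\<in>?J. renewal_at X t \<omega>} = 1 / 2 ^ card ?J"
    proof (cases "?J = {}")
      case True
      show ?thesis unfolding True by (simp add: X.prob_space)
    next
      case False
      define m where "m = Min ?J"
      define k where "k = card ?J"
      have m: "m \<in> ?J" "\<And>t. t \<in> ?J \<Longrightarrow> m \<le> t"
        using Min_in[of ?J] Min_le[of ?J] fin False by (auto simp: m_def)
      have k: "k \<ge> 1" using False fin by (simp add: k_def card_gt_0_iff Suc_le_eq)
      have m1: "m \<ge> 1" using m(1) by simp
      have mass: "measure M {\<omega>\<in>space M. \<forall>t\<in>(\<lambda>t. t - s) ` ?J. renewal_at (shift X) t \<omega>} =
          1 / 2 ^ (if s = m then k - 1 else k)" if s: "s \<in> {1..m}" for s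
      proof -
        have "measure M {\<omega>\<in>space M. \<forall>t\<in>(\<lambda>t. t - s) ` ?J. renewal_at (shift X) t \<omega>} =
          1 / 2 ^ card ((\<lambda>t. t - s) ` ?J - {0})"
        proof (rule less.IH[OF _ _ X.iid_shift])
          show "n - s < n" using s m(1) less.prems(1) by auto
          show "(\<lambda>t. t - s) ` ?J \<subseteq> {..n - s}" using less.prems(1) by (auto intro: diff_le_mono)
        qed
        also have "(\<lambda>t. t - s) ` ?J - {0} = (\<lambda>t. t - s) ` (?J - {t. t = m \<and> s = m})"
          using s m(2) by (force simp: image_iff)
        also have "card \<dots> = card (?J - {t. t = m \<and> s = m})"
          by (rule card_image) (use m(2) s in \<open>force simp: inj_on_def\<close>)
        also have "\<dots> = (if s = m then k - 1 else k)"
          using m(1) fin by (auto simp: k_def)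
        finally show ?thesis .
      qed
      have "measure M {\<omega>\<in>space M. \<forall>t\<in>?J. renewal_at X t \<omega>} =
         (\<Sum>s=1..m. (1 / 2 ^ s) * (1 / 2 ^ (if s = m then k - 1 else k)))"
        by (subst X.first_renewal_decomposition[OF False _ m(1) m1], erule m(2))
           (intro sum.cong refl, simp only: mass, simp add: \<psi>)
      also have "\<dots> = (\<Sum>s=1..m-1. (1 / 2 ^ s) * (1 / 2 ^ k)) + (1 / 2 ^ m) * (1 / 2 ^ (k - 1))"
      proof -
        have "{1..m} = insert m {1..m-1}" using m1 by auto
        then show ?thesis using m1 by (auto intro!: sum.cong)
      qed
      also have "\<dots> = (1 - 1 / 2 ^ (m - 1)) * (1 / 2 ^ k) + (1 / 2 ^ m) * (1 / 2 ^ (k - 1))"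
        by (simp only: sum_half_powers flip: sum_distrib_right)
      also have "\<dots> = 1 / 2 ^ k"
        using k m1 by (cases k; cases m) (auto simp: field_simps)
      finally show ?thesis by (simp add: k_def)
    qed
    ultimately show ?case by simp
  qed
qed

section \<open>Conditions that force the geometric density\<close>

context iid_waiting_times
begin

lemma prob_X_gt_Suc: "prob {\<omega>\<in>space M. X 0 \<omega> > t} = \<psi> (Suc t) + prob {\<omega>\<in>space M. X 0 \<omega> > Suc t}"
proof -
  have "{\<omega>\<in>space M. X 0 \<omega> > t} = {\<omega>\<in>space M. X 0 \<omega> = Suc t} \<union> {\<omega>\<in>space M. X 0 \<omega> > Suc t}"
    by auto
  also have "prob \<dots> = prob {\<omega>\<in>space M. X 0 \<omega> = Suc t} + prob {\<omega>\<in>space M. X 0 \<omega> > Suc t}"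
    by (rule finite_measure_Union) auto
  finally show ?thesis by (simp add: law)
qed

lemma geometric_if_tail:
  assumes "\<And>t. prob {\<omega>\<in>space M. X 0 \<omega> > t} = 1 / 2 ^ t" and "t \<ge> 1"
  shows "\<psi> t = 1 / 2 ^ t"
proof -
  from \<open>t \<ge> 1\<close> obtain s where "t = Suc s" by (cases t) auto
  then show ?thesis using prob_X_gt_Suc[of s] by (simp add: assms(1))
qed

text \<open>Because \<open>0\<^sup>0 = 1\<close>, the walk generating function at \<open>(0,1)\<close> retains exactly the event \<open>N(t) = 0\<close>.\<close>

lemma walk_gf_0_1: "walk_gf M X 0 1 t = prob {\<omega>\<in>space M. X 0 \<omega> > t}"
proof -
  have "walk_gf M X 0 1 t = (LINT \<omega>|M. indicator {\<omega>\<in>space M. X 0 \<omega> > t} \<omega>)"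
    unfolding walk_gf_def
  proof (rule Bochner_Integration.integral_cong[OF refl])
    fix \<omega> assume w: "\<omega> \<in> space M"
    interpret positive_waiting_times X \<omega> by (rule positive_waiting_times[OF w])
    show "0 ^ renewal_count X t \<omega> * 1 ^ (t - renewal_count X t \<omega>) =
      (indicator {\<omega>\<in>space M. X 0 \<omega> > t} \<omega> :: real)"
      using w renewal_count_eq_0_iff[of t] by (auto simp: power_0_left)
  qed
  then show ?thesis by simp
qed

text \<open>
  At \<open>(1,0)\<close> only the event \<open>N(t) = t\<close> is retained; it forces the first \<open>t\<close> waiting times to be \<open>1\<close>.
\<close>

lemma walk_gf_1_0: "walk_gf M X 1 0 t = \<psi> 1 ^ t"
proof -
  have "walk_gf M X 1 0 t = (LINT \<omega>|M. indicator {\<omega>\<in>space M. \<forall>j<t. X j \<omega> = 1} \<omega>)"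
    unfolding walk_gf_def
  proof (rule Bochner_Integration.integral_cong[OF refl])
    fix \<omega> assume w: "\<omega> \<in> space M"
    interpret positive_waiting_times X \<omega> by (rule positive_waiting_times[OF w])
    show "1 ^ renewal_count X t \<omega> * 0 ^ (t - renewal_count X t \<omega>) =
      (indicator {\<omega>\<in>space M. \<forall>j<t. X j \<omega> = 1} \<omega> :: real)"
      using w renewal_count_eq_self_iff[of t] renewal_count_le[of t]
      by (auto simp: power_0_left indicator_def)
  qed
  also have "\<dots> = prob {\<omega>\<in>space M. \<forall>j<t. X j \<omega> = 1}" by simp
  also have "\<dots> = \<psi> 1 ^ t"
  proof (cases "t = 0")
    case False
    have "{\<omega>\<in>space M. \<forall>j<t. X j \<omega> = 1} = (\<Inter>j\<in>{..<t}. X j -` {1} \<inter> space M)"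
      using False by auto
    also have "prob \<dots> = (\<Prod>j<t. prob (X j -` {1} \<inter> space M))"
      by (rule indep_varsD[OF indep]) (use False in auto)
    also have "\<dots> = (\<Prod>j<t. prob {\<omega>\<in>space M. X j \<omega> = 1})"
      by (intro prod.cong refl arg_cong[where f = prob]) auto
    finally show ?thesis by (simp add: law)
  qed (simp add: prob_space)
  finally show ?thesis .
qed

text \<open>
  The symmetry in the two arguments at \<open>(0,1)\<close> makes the first waiting time geometric with success
  probability \<open>1 - \<psi> 1\<close>, while \<open>\<psi> 1\<close> is also its probability of being \<open>1\<close>; so both are \<open>1/2\<close>.
\<close>

lemma geometric_if_strictly_unbiased:
  assumes "strictly_unbiased M \<psi> X" and "t \<ge> 1"
  shows "\<psi> t = 1 / 2 ^ t"
proof -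
  have tail: "prob {\<omega>\<in>space M. X 0 \<omega> > t} = \<psi> 1 ^ t" for t
    using assms(1) unfolding walk_gf_0_1[symmetric] walk_gf_1_0[symmetric]
    by (simp add: strictly_unbiased_def)
  have "\<psi> 1 = 1 / 2" using prob_X_gt_Suc[of 0] tail[of 0] tail[of 1] by simp
  then have "prob {\<omega>\<in>space M. X 0 \<omega> > t} = 1 / 2 ^ t" for t
    by (simp only: tail power_one_over)
  then show ?thesis using assms(2) by (rule geometric_if_tail)
qed

lemma integrable_renewal_indicator:
  "integrable M (indicator {\<omega>\<in>space M. renewal_at X t \<omega>} :: 'a \<Rightarrow> real)"
  by (rule integrable_real_indicator) (auto simp: less_top[symmetric])

lemma expectation_renewal_count:
  "(LINT \<omega>|M. real (renewal_count X t \<omega>)) = (\<Sum>s<t. prob {\<omega>\<in>space M. renewal_at X (Suc s) \<omega>})"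
proof -
  have "(LINT \<omega>|M. real (renewal_count X t \<omega>)) =
    (LINT \<omega>|M. (\<Sum>s<t. indicator {\<omega>\<in>space M. renewal_at X (Suc s) \<omega>} \<omega>))"
    by (intro Bochner_Integration.integral_cong refl)
       (auto simp: positive_waiting_times.renewal_count_eq_sum[OF positive_waiting_times]
          indicator_def intro!: sum.cong)
  also have "\<dots> = (\<Sum>s<t. prob {\<omega>\<in>space M. renewal_at X (Suc s) \<omega>})"
    by (subst Bochner_Integration.integral_sum[OF integrable_renewal_indicator]) simp
  finally show ?thesis .
qed

lemma expectation_walk:
  "(LINT \<omega>|M. real_of_int (simple_ADTRW X t \<omega>)) =
     2 * (\<Sum>s<t. prob {\<omega>\<in>space M. renewal_at X (Suc s) \<omega>}) - real t"
proof -
  have "integrable M (\<lambda>\<omega>. real (renewal_count X t \<omega>))"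
  proof (subst Bochner_Integration.integrable_cong[OF refl])
    show "integrable M (\<lambda>\<omega>. \<Sum>s<t. indicator {\<omega>\<in>space M. renewal_at X (Suc s) \<omega>} \<omega> :: real)"
      by (intro Bochner_Integration.integrable_sum integrable_renewal_indicator)
  qed (auto simp: positive_waiting_times.renewal_count_eq_sum[OF positive_waiting_times]
          indicator_def intro!: sum.cong)
  then show ?thesis
    by (simp add: simple_ADTRW_def prob_space flip: expectation_renewal_count)
qed

lemma renewal_mass_half_if_centred:
  assumes "\<And>t. (LINT \<omega>|M. real_of_int (simple_ADTRW X t \<omega>)) = 0" and "t \<ge> 1"
  shows "prob {\<omega>\<in>space M. renewal_at X t \<omega>} = 1 / 2"
proof -
  from \<open>t \<ge> 1\<close> obtain s where "t = Suc s" by (cases t) auto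
  then show ?thesis
    using assms(1)[of s] assms(1)[of t] by (simp add: expectation_walk)
qed

text \<open>
  Every positive time carries the renewal mass \<open>1/2\<close>, but time \<open>0\<close> carries the mass \<open>1\<close>. In the
  renewal equation the summand \<open>s = t\<close> is therefore \<open>\<psi> t\<close>, and the others are halved.
\<close>

lemma geometric_if_centred:
  assumes "\<And>t. (LINT \<omega>|M. real_of_int (simple_ADTRW X t \<omega>)) = 0" and "t \<ge> 1"
  shows "\<psi> t = 1 / 2 ^ t"
  using \<open>t \<ge> 1\<close>
proof (induction t rule: less_induct)
  case (less t)
  note half = renewal_mass_half_if_centred[OF assms(1)]
  have sh: "prob {\<omega>\<in>space M. renewal_at (shift X) s \<omega>} = (if s = 0 then 1 else 1 / 2)" for s
    using half[of s] renewal_mass_unique[OF iid_waiting_times_axioms iid_shift, of s]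
    by (simp add: prob_space)
  have "1 / 2 = (\<Sum>s=1..t. \<psi> s * (if t - s = 0 then 1 else 1 / 2))"
    using first_renewal_decomposition[of "{t}" t] half[of t] less.prems by (simp add: sh)
  also have "\<dots> = (\<Sum>s=1..t-1. \<psi> s * (1 / 2)) + \<psi> t"
  proof -
    have "{1..t} = insert t {1..t-1}" using less.prems by auto
    then show ?thesis using less.prems by (auto intro!: sum.cong)
  qed
  also have "(\<Sum>s=1..t-1. \<psi> s * (1 / 2)) = (\<Sum>s=1..t-1. 1 / 2 ^ s) * (1 / 2)"
    unfolding sum_distrib_right using less.IH by (intro sum.cong) auto
  finally have "1 / 2 = (1 - 1 / 2 ^ (t - 1)) * (1 / 2) + \<psi> t" by (simp only: sum_half_powers)
  then show ?case using less.prems by (cases t) (simp_all add: field_simps)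
qed

lemma centred_if_geometric:
  assumes "\<And>t. t \<ge> 1 \<Longrightarrow> \<psi> t = 1 / 2 ^ t"
  shows "(LINT \<omega>|M. real_of_int (simple_ADTRW X t \<omega>)) = 0"
proof -
  have "prob {\<omega>\<in>space M. renewal_at X (Suc s) \<omega>} = 1 / 2" for s
    using prob_renewals_geometric[OF iid_waiting_times_axioms assms, of "{Suc s}"] by simp
  then show ?thesis by (simp only: expectation_walk) simp
qed

section \<open>The Bernoulli process\<close>

text \<open>
  Each increment is the indicator of a single event \<open>R t\<close>. A singleton class is closed under
  intersection, so the product formula for these events alone already yields independence of the
  generated sigma-algebras, and hence of the increments.
\<close>

lemma bernoulli_if_geometric:
  assumes \<psi>: "\<And>t. t \<ge> 1 \<Longrightarrow> \<psi> t = 1 / 2 ^ t"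
  shows "bernoulli_process M (1/2) (renewal_count X)"
proof -
  let ?D = "\<lambda>t \<omega>. int (renewal_count X (Suc t) \<omega>) - int (renewal_count X t \<omega>)"
  define R where "R t = {\<omega>\<in>space M. renewal_at X (Suc t) \<omega>}" for t
  have R [measurable]: "R t \<in> events" for t unfolding R_def by measurable
  have D: "?D t \<omega> = of_bool (\<omega> \<in> R t)" if "\<omega> \<in> space M" for t \<omega>
    using that positive_waiting_times.renewal_count_Suc[OF positive_waiting_times[OF that], of t]
    by (auto simp: R_def)
  have vimage: "?D t -` A \<inter> space M = 
      (if 1 \<in> A then R t else {}) \<union> (if 0 \<in> A then space M - R t else {})" for t A
    using D[of _ t] sets.sets_into_space[OF R[of t]] by (auto split: if_splits simp: of_bool_def)
  have rv: "?D t \<in> measurable M (count_space UNIV)" for t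
    by (rule measurableI) (auto simp: vimage)
  have RJ: "prob (\<Inter>j\<in>J. R j) = 1 / 2 ^ card J" if "J \<noteq> {}" "finite J" for J
  proof -
    have "(\<Inter>j\<in>J. R j) = {\<omega>\<in>space M. \<forall>t\<in>Suc ` J. renewal_at X t \<omega>}"
      using that by (auto simp: R_def)
    moreover have "Suc ` J - {0} = Suc ` J" by auto
    ultimately show ?thesis
      using prob_renewals_geometric[OF iid_waiting_times_axioms \<psi>, of "Suc ` J"] that
      by (simp add: card_image)
  qed
  have half: "prob (R t) = 1 / 2" for t using RJ[of "{t}"] by simp
  have "indep_sets (\<lambda>t. {R t}) UNIV"
    by (rule indep_setsI) (auto simp: RJ half power_one_over)
  then have "indep_sets (\<lambda>t. sigma_sets (space M) {R t}) UNIV"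
    by (rule indep_sets_sigma) (simp add: Int_stable_def)
  then have "indep_sets (\<lambda>t. {?D t -` A \<inter> space M | A. A \<in> sets (count_space UNIV)}) UNIV"
  proof (rule indep_sets_mono)
    fix t
    interpret sigma_algebra "space M" "sigma_sets (space M) {R t}"
      by (rule sigma_algebra_sigma_sets) (use sets.sets_into_space[OF R[of t]] in auto)
    have "R t \<in> sigma_sets (space M) {R t}" by auto
    then show "{?D t -` A \<inter> space M | A. A \<in> sets (count_space UNIV)} \<subseteq> sigma_sets (space M) {R t}"
      by (auto simp: vimage)
  qed simp
  then have ind: "indep_vars (\<lambda>_. count_space UNIV) ?D UNIV"
    unfolding indep_vars_def2 using rv by auto
  have "distr M (count_space UNIV) (?D t) = measure_pmf (map_pmf of_bool (bernoulli_pmf (1/2)))" for t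
  proof (rule measure_eqI_countable[of _ UNIV])
    fix a :: int
    have "of_bool -` {a} = (if a = 1 then {True} else if a = 0 then {False} else {})"
      by (auto simp: of_bool_def split: if_splits)
    then have "prob (?D t -` {a} \<inter> space M) = pmf (map_pmf of_bool (bernoulli_pmf (1/2))) a"
      using sets.sets_into_space[OF R[of t]]
      by (auto simp: vimage half prob_compl pmf_map measure_pmf_single)
    then show "emeasure (distr M (count_space UNIV) (?D t)) {a} =
      emeasure (measure_pmf (map_pmf of_bool (bernoulli_pmf (1/2)))) {a}"
      using rv[of t] by (simp add: emeasure_distr emeasure_eq_measure emeasure_pmf_single)
  qed auto
  then show ?thesis
    unfolding bernoulli_process_def
    using ind positive_waiting_times.renewal_count_0[OF positive_waiting_times] by auto
qed

text \<open>
  Each step multiplies the integrand by \<open>a\<close> when there is a renewal and by \<open>b\<close> otherwise. The integrand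
  is thus a product of independent factors with mean \<open>(a + b) / 2\<close>.
\<close>

lemma walk_gf_if_bernoulli:
  assumes B: "bernoulli_process M (1/2) (renewal_count X)"
  shows "walk_gf M X a b t = ((a + b) / 2) ^ t"
proof -
  let ?D = "\<lambda>t \<omega>. int (renewal_count X (Suc t) \<omega>) - int (renewal_count X t \<omega>)"
  \<comment> \<open>An increment is never outside \<open>{0, 1}\<close>; the value \<open>0\<close> there only keeps the function bounded.\<close>
  let ?f = "\<lambda>i::int. if i = 1 then a else if i = 0 then b else 0"
  have ind: "indep_vars (\<lambda>_. count_space UNIV) ?D UNIV"
    and dist: "\<And>t. distr M (count_space UNIV) (?D t) = measure_pmf (map_pmf of_bool (bernoulli_pmf (1/2)))"
    using B by (auto simp: bernoulli_process_def)
  have rv [measurable]: "?D t \<in> measurable M (count_space UNIV)" for t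
    using ind by (simp add: indep_vars_def)
  have prod: "a ^ renewal_count X t \<omega> * b ^ (t - renewal_count X t \<omega>) = (\<Prod>s<t. ?f (?D s \<omega>))"
    if w: "\<omega> \<in> space M" for \<omega>
  proof -
    interpret positive_waiting_times X \<omega> by (rule positive_waiting_times[OF w])
    show ?thesis
    proof (induction t)
      case (Suc t)
      then show ?case using renewal_count_le[of t] by (auto simp: renewal_count_Suc Suc_diff_le)
    qed (simp add: renewal_count_0)
  qed
  have int: "integrable M (\<lambda>\<omega>. ?f (?D s \<omega>))" for s
    by (rule integrable_const_bound[of _ "\<bar>a\<bar> + \<bar>b\<bar>"]) auto
  have mean: "(LINT \<omega>|M. ?f (?D s \<omega>)) = (a + b) / 2" for s
  proof -
    have "(LINT \<omega>|M. ?f (?D s \<omega>)) = (LINT i|distr M (count_space UNIV) (?D s). ?f i)"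
      by (rule integral_distr[symmetric]) auto
    also have "\<dots> = (a + b) / 2" unfolding dist by simp
    finally show ?thesis .
  qed
  have "walk_gf M X a b t = (LINT \<omega>|M. (\<Prod>s<t. ?f (?D s \<omega>)))"
    unfolding walk_gf_def by (intro Bochner_Integration.integral_cong refl prod)
  also have "\<dots> = (\<Prod>s<t. LINT \<omega>|M. ?f (?D s \<omega>))"
  proof (rule indep_vars_lebesgue_integral)
    show "indep_vars (\<lambda>_. borel) (\<lambda>s \<omega>. ?f (?D s \<omega>)) {..<t}"
      by (rule indep_vars_compose2[OF indep_vars_subset[OF ind]]) auto
  qed (use int in auto)
  finally show ?thesis by (simp add: mean)
qed

lemma geometric_if_bernoulli:
  assumes "bernoulli_process M (1/2) (renewal_count X)" and "t \<ge> 1"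
  shows "\<psi> t = 1 / 2 ^ t"
  using walk_gf_if_bernoulli[OF assms(1), of 0 1] walk_gf_0_1 assms(2)
  by (intro geometric_if_tail) (simp_all add: power_one_over)

end

section \<open>Mean and generating function of the geometric density\<close>

lemma mean_geometric:
  assumes "\<And>t. t \<ge> 1 \<Longrightarrow> \<psi> t = 1 / 2 ^ t"
  shows "((\<lambda>t. real t * \<psi> t) has_sum 2) {1..}"
proof -
  have "(\<lambda>n. real (Suc n) * (1/2) ^ n * (1/2)) sums (1 / (1 - 1/2)\<^sup>2 * (1/2))"
    by (intro sums_mult2 geometric_deriv_sums) simp
  then have "(\<lambda>n. real (Suc n) / 2 ^ Suc n) sums 2"
    by (simp add: power2_eq_square power_one_over field_simps)
  then have "(\<lambda>n. real n / 2 ^ n) sums 2" by (subst (asm) sums_Suc_iff) simp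
  then have "((\<lambda>n. real n / 2 ^ n) has_sum 2) UNIV" by (intro sums_nonneg_imp_has_sum) auto
  then show ?thesis
    by (rule has_sum_cong_neutral[THEN iffD1, rotated -1]) (auto simp: assms)
qed

lemma waiting_time_gf_geometric:
  assumes "\<And>t. t \<ge> 1 \<Longrightarrow> \<psi> t = 1 / 2 ^ t" and "\<bar>u\<bar> \<le> 1"
  shows "waiting_time_gf \<psi> u = u / (2 * (1 - u / 2))"
proof -
  have "((\<lambda>t. (u / 2) ^ t) has_sum (u / 2 / (1 - u / 2))) {1..}"
    using has_sum_geometric_from_1[of "u / 2"] assms(2) by simp
  then have "((\<lambda>t. \<psi> t * u ^ t) has_sum (u / 2 / (1 - u / 2))) {1..}"
    by (rule has_sum_cong[THEN iffD1, rotated]) (simp add: assms(1) power_divide)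
  then show ?thesis unfolding waiting_time_gf_def by (simp add: infsumI)
qed

text \<open>
  As a power series over all naturals; the coefficient at \<open>0\<close> is set to \<open>0\<close> because \<open>\<psi> 0\<close> is arbitrary.
\<close>

lemma waiting_time_gf_sums:
  assumes "waiting_time_density \<psi>" and "\<bar>u\<bar> \<le> 1"
  shows "(\<lambda>t. (if t = 0 then 0 else \<psi> t) * u ^ t) sums waiting_time_gf \<psi> u"
proof -
  have "(\<lambda>t. \<psi> t * u ^ t) summable_on {1..}"
  proof (rule abs_summable_summable, rule summable_on_comparison_test)
    show "\<psi> summable_on {1..}"
      using assms(1) by (auto simp: waiting_time_density_def summable_on_def)
  next
    fix t :: nat assume "t \<in> {1..}"
    then have "\<psi> t \<ge> 0" using assms(1) by (auto simp: waiting_time_density_def)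
    moreover have "\<bar>u\<bar> ^ t \<le> 1" using assms(2) by (simp add: power_le_one)
    ultimately show "norm (\<psi> t * u ^ t) \<le> \<psi> t"
      by (simp add: abs_mult power_abs mult_left_le)
  qed auto
  then have "((\<lambda>t. \<psi> t * u ^ t) has_sum waiting_time_gf \<psi> u) {1..}"
    by (simp add: waiting_time_gf_def has_sum_infsum)
  then have "((\<lambda>t. (if t = 0 then 0 else \<psi> t) * u ^ t) has_sum waiting_time_gf \<psi> u) UNIV"
    by (rule has_sum_cong_neutral[THEN iffD1, rotated -1]) (auto simp: not_le)
  then show ?thesis by (rule has_sum_imp_sums)
qed

text \<open>
  A difference of two generating functions that agree near \<open>0\<close> is a power series with sum \<open>0\<close>, and a
  nonzero coefficient would make it nonzero on a punctured neighbourhood of \<open>0\<close>.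
\<close>

lemma waiting_time_gf_inject:
  assumes "waiting_time_density \<psi>" "waiting_time_density \<phi>"
    and "\<And>u. \<bar>u\<bar> \<le> 1 \<Longrightarrow> waiting_time_gf \<psi> u = waiting_time_gf \<phi> u" and "t \<ge> 1"
  shows "\<psi> t = \<phi> t"
proof (rule ccontr)
  assume ne: "\<psi> t \<noteq> \<phi> t"
  define a where "a t = (if t = 0 then 0 else \<psi> t) - (if t = 0 then 0 else \<phi> t)" for t :: nat
  have "(\<lambda>t. a t * u ^ t) sums 0" if "norm u < 1" for u
    using sums_diff[OF waiting_time_gf_sums[OF assms(1), of u] waiting_time_gf_sums[OF assms(2), of u]]
      assms(3)[of u] that
    by (simp add: a_def left_diff_distrib)
  moreover have "t > 0" "a t \<noteq> 0" using ne assms(4) by (auto simp: a_def)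
  ultimately obtain s where s: "s > 0" "\<And>z::real. z \<in> cball 0 s - {0} \<Longrightarrow> (0::real) \<noteq> 0"
    using powser_0_nonzero[of 1 0 a "\<lambda>_. 0" t] by auto
  from s(2)[of s] s(1) show False by auto
qed

lemma waiting_time_density_geometric: "waiting_time_density (\<lambda>t. 1 / 2 ^ t)"
  unfolding waiting_time_density_def
  using has_sum_geometric_from_1[of "1/2::real"] by (auto simp: power_one_over)

section \<open>The characterization\<close>

theorem mainTheorem3:
  fixes M :: "'a measure" and \<psi> :: "nat \<Rightarrow> real" and X :: "nat \<Rightarrow> 'a \<Rightarrow> nat"
  assumes "iid_waiting_times M \<psi> X"
  shows "(strictly_unbiased M \<psi> X \<longleftrightarrow> bernoulli_process M (1/2) (renewal_count X)) \<and>
         (bernoulli_process M (1/2) (renewal_count X) \<longleftrightarrow> (\<forall>t\<ge>1. \<psi> t = 1 / 2 ^ t)) \<and>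
         ((\<forall>t\<ge>1. \<psi> t = 1 / 2 ^ t) \<longleftrightarrow>
            (\<forall>u. \<bar>u\<bar> \<le> 1 \<longrightarrow> waiting_time_gf \<psi> u = u / (2 * (1 - u / 2)))) \<and>
         ((\<forall>t. (LINT \<omega>|M. real_of_int (simple_ADTRW X t \<omega>)) = 0) \<longleftrightarrow> (\<forall>t\<ge>1. \<psi> t = 1 / 2 ^ t))"
proof -
  interpret iid_waiting_times M \<psi> X by fact
  let ?geometric = "\<forall>t\<ge>1. \<psi> t = 1 / 2 ^ t"
  have B: "bernoulli_process M (1/2) (renewal_count X) \<longleftrightarrow> ?geometric"
    using bernoulli_if_geometric geometric_if_bernoulli by blast
  have U: "strictly_unbiased M \<psi> X \<longleftrightarrow> bernoulli_process M (1/2) (renewal_count X)"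
  proof
    assume "strictly_unbiased M \<psi> X"
    then show "bernoulli_process M (1/2) (renewal_count X)"
      using geometric_if_strictly_unbiased B by blast
  next
    assume bern: "bernoulli_process M (1/2) (renewal_count X)"
    then show "strictly_unbiased M \<psi> X"
      using mean_geometric[of \<psi>] B
      by (simp add: strictly_unbiased_def walk_gf_if_bernoulli[OF bern] add.commute)
  qed
  have G: "?geometric \<longleftrightarrow>
      (\<forall>u. \<bar>u\<bar> \<le> 1 \<longrightarrow> waiting_time_gf \<psi> u = u / (2 * (1 - u / 2)))"
  proof
    assume gf: "\<forall>u. \<bar>u\<bar> \<le> 1 \<longrightarrow> waiting_time_gf \<psi> u = u / (2 * (1 - u / 2))"
    show ?geometric
    proof (intro allI impI)
      fix t :: nat assume "t \<ge> 1"
      then show "\<psi> t = 1 / 2 ^ t"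
        using gf waiting_time_gf_geometric[of "\<lambda>t. 1 / 2 ^ t"]
        by (intro waiting_time_gf_inject[OF density waiting_time_density_geometric, of t]) simp_all
    qed
  qed (use waiting_time_gf_geometric in blast)
  have C: "(\<forall>t. (LINT \<omega>|M. real_of_int (simple_ADTRW X t \<omega>)) = 0) \<longleftrightarrow> ?geometric"
    using centred_if_geometric geometric_if_centred by blast
  from U B G C show ?thesis by blast
qed

end
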